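(* Let $X$ be a topological space and let $P\in X$. Assume that $(X,P)$ is Fréchet–Urysohn at $P$, that $X$ is $T_1$ at $P$, that $P$ is non-isolated, and that there exists a function $f:X\to\mathbb{R}$ that is discontinuous at $P$. Let $\mathcal{F}$ be the family of all test sets at $P$, partially ordered by inclusion. Then $(\mathcal{F},\subseteq)$ has a minimal element, i.e. there is $A\in\mathcal{F}$ such that for every $B\in\mathcal{F}$, $B\subseteq A$ implies $B=A$.
   Context: Fix a topological space $X$ and $P\in X$. Sequences are indexed by $\mathbb{N}=\{1,2,3,\dots\}$. $(X,P)$ is Fréchet–Urysohn at $P$ if for every $A\subseteq X$ with $P\in\overline{A}$ there is a sequence $(a_n)_{n\in\mathbb{N}}$ of points of $A$ with $a_n\to P$. $X$ is $T_1$ at $P$ if for every $x\in X$ with $x\neq P$ there is an open neighborhood $U$ of $P$ with $x\notin U$. $P$ is non-isolated if every neighborhood of $P$ contains a point $x\ne P$. $\mathcal{S}_P$ is the set of all sequences $T=(T_n)_{n\in\mathbb{N}}$ in $X$ with $T_n\to P$. $\mathcal{D}_P$ is the set of all functions $f:X\to\mathbb{R}$ that are discontinuous at $P$. For $f\in\mathcal{D}_P$, $D(f)=\{T\in\mathcal{S}_P : f(T_n)\not\to f(P)\}$. A subset $A\subseteq\mathcal{S}_P$ is a test set if $A\cap D(f)\neq\emptyset$ for every $f\in\mathcal{D}_P$. $\mathcal{F}$ denotes the family of all test sets. *)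

theory Defs
  imports "HOL-Analysis.Analysis"
begin

text \<open>Sequences are functions on \<^typ>\<open>nat\<close>, that is, they are indexed from 0 instead of 1.\<close>

definition frechet_urysohn_at :: "'a::topological_space \<Rightarrow> bool" where
  "frechet_urysohn_at P \<longleftrightarrow>
     (\<forall>A. P \<in> closure A \<longrightarrow> (\<exists>a :: nat \<Rightarrow> 'a. (\<forall>n. a n \<in> A) \<and> a \<longlonglongrightarrow> P))"

definition t1_at :: "'a::topological_space \<Rightarrow> bool" where
  "t1_at P \<longleftrightarrow> (\<forall>x. x \<noteq> P \<longrightarrow> (\<exists>U. open U \<and> P \<in> U \<and> x \<notin> U))"

definition seqs_to :: "'a::topological_space \<Rightarrow> (nat \<Rightarrow> 'a) set" where
  "seqs_to P = {T. T \<longlonglongrightarrow> P}"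

text \<open>\<^const>\<open>isCont\<close> is available only on Hausdorff domains, hence \<^const>\<open>topcontinuous_at\<close>.\<close>

definition discont_funs :: "'a::topological_space \<Rightarrow> ('a \<Rightarrow> real) set" where
  "discont_funs P = {f. \<not> topcontinuous_at euclidean euclideanreal f P}"

definition detecting_seqs :: "'a::topological_space \<Rightarrow> ('a \<Rightarrow> real) \<Rightarrow> (nat \<Rightarrow> 'a) set" where
  "detecting_seqs P f = {T \<in> seqs_to P. \<not> (\<lambda>n. f (T n)) \<longlonglongrightarrow> f P}"

definition test_sets :: "'a::topological_space \<Rightarrow> (nat \<Rightarrow> 'a) set set" where
  "test_sets P =
     {A. A \<subseteq> seqs_to P \<and> (\<forall>f \<in> discont_funs P. A \<inter> detecting_seqs P f \<noteq> {})}"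

end

theory Submission
  imports Defs
begin

text \<open>
  A function f is discontinuous at P iff P lies in the closure of some set where f stays away from
  f P; by the Frechet--Urysohn property such a set contains a sequence converging to P, and by the
  T1 property this sequence may be taken injective. By Zorn's lemma there is a maximal family of
  injective sequences of points other than P converging to P whose ranges pairwise have finite
  intersection. It is a test set by maximality. It is minimal because the indicator function of the
  range of a member T is detected by T but by no other member.
\<close>

lemma topcontinuous_at_euclidean_iff:
  fixes f :: "'a::topological_space \<Rightarrow> real"
  shows "topcontinuous_at euclidean euclideanreal f P \<longleftrightarrow> (f \<longlongrightarrow> f P) (nhds P)"
  by (auto simp: topcontinuous_at_def tendsto_def eventually_nhds)

text \<open>This puts discontinuity in the form to which the Frechet--Urysohn property applies. It
  holds because the complement of a closure is the interior of the complement.\<close>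

lemma discont_funs_iff:
  "f \<in> discont_funs P \<longleftrightarrow> (\<exists>e>0. P \<in> closure {x. e \<le> \<bar>f x - f P\<bar>})"
proof -
  have "f \<in> discont_funs P \<longleftrightarrow> \<not> (\<forall>e>0. \<forall>\<^sub>F x in nhds P. \<bar>f x - f P\<bar> < e)"
    by (simp add: discont_funs_def topcontinuous_at_euclidean_iff tendsto_iff dist_real_def)
  moreover have "P \<in> closure {x. e \<le> \<bar>f x - f P\<bar>} \<longleftrightarrow> \<not> (\<forall>\<^sub>F x in nhds P. \<bar>f x - f P\<bar> < e)" for e
    by (auto simp: closure_interior interior_def eventually_nhds subset_iff not_le)
  ultimately show ?thesis
    by simp
qed

text \<open>A neighbourhood of \<open>P\<close> misses only finitely many values of
  \<open>a\<close>, and the injective \<open>g\<close> takes each of these at most once. No monotone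
  choice of indices is needed to pass from \<open>a\<close> to \<open>g\<close>.\<close>

lemma inj_tendsto_if_range_subset:
  fixes a g :: "nat \<Rightarrow> 'a::topological_space"
  assumes "a \<longlonglongrightarrow> P" "inj g" "range g \<subseteq> range a"
  shows "g \<longlonglongrightarrow> P"
proof (rule topological_tendstoI)
  fix U assume "open U" "P \<in> U"
  then have "finite {n. a n \<notin> U}"
    using topological_tendstoD[OF assms(1)] by (simp add: eventually_cofinite flip: cofinite_eq_sequentially)
  moreover have "g ` {n. g n \<notin> U} \<subseteq> a ` {n. a n \<notin> U}"
    using assms(3) by (force simp: subset_iff)
  ultimately have "finite {n. g n \<notin> U}"
    by (meson assms(2) finite_imageD finite_imageI finite_subset inj_on_subset subset_UNIV)
  then show "\<forall>\<^sub>F n in sequentially. g n \<in> U"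
    by (simp add: eventually_cofinite flip: cofinite_eq_sequentially)
qed

text \<open>By T1 at \<open>P\<close>, the sequence eventually avoids each single value in its
  range. If there were only finitely many values, it would eventually avoid all of them at
  once.\<close>

lemma infinite_range_if_tendsto_t1_at:
  fixes a :: "nat \<Rightarrow> 'a::topological_space"
  assumes "t1_at P" "a \<longlonglongrightarrow> P" "P \<notin> range a"
  shows "infinite (range a)"
proof
  assume fin: "finite (range a)"
  have "\<forall>\<^sub>F n in sequentially. a n \<noteq> x" if "x \<in> range a" for x
  proof -
    have "x \<noteq> P"
      using that assms(3) by metis
    then obtain U where U: "open U" "P \<in> U" "x \<notin> U"
      using assms(1) unfolding t1_at_def by blast
    from topological_tendstoD[OF assms(2) U(1,2)] show ?thesis
      by (rule eventually_mono) (use U(3) in metis)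
  qed
  then have "\<forall>\<^sub>F n in sequentially. \<forall>x\<in>range a. a n \<noteq> x"
    using fin by (intro eventually_ball_finite) blast+
  then show False
    by (auto simp: eventually_sequentially)
qed

text \<open>Injectivity lets finiteness pass between sets of points and sets of indices. Avoiding
  \<open>P\<close> makes the indicator of \<open>range T\<close> vanish at \<open>P\<close>.\<close>

definition almost_disjoint_seqs :: "'a::topological_space \<Rightarrow> (nat \<Rightarrow> 'a) set set" where
  "almost_disjoint_seqs P =
     {M. M \<subseteq> {T. T \<longlonglongrightarrow> P \<and> inj T \<and> P \<notin> range T} \<and>
         pairwise (\<lambda>S T. finite (range S \<inter> range T)) M}"

lemma maximal_almost_disjoint_seqs:
  obtains M where "M \<in> almost_disjoint_seqs P"
    and "\<And>M'. M' \<in> almost_disjoint_seqs P \<Longrightarrow> M \<subseteq> M' \<Longrightarrow> M' = M"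
proof -
  have "\<Union>C \<in> almost_disjoint_seqs P" if "subset.chain (almost_disjoint_seqs P) C" for C
    using that pairwise_chain_Union[of C "\<lambda>S T. finite (range S \<inter> range T)"]
    unfolding almost_disjoint_seqs_def subset_chain_def chain_subset_def by blast
  then show thesis
    using subset_Zorn'[of "almost_disjoint_seqs P"] that by blast
qed

text \<open>Otherwise an injective \<open>g\<close> with values in \<open>range a\<close> could be
  added to \<open>M\<close>.\<close>

lemma maximal_almost_disjoint_seqs_meets:
  assumes "M \<in> almost_disjoint_seqs P"
    and max: "\<And>M'. M' \<in> almost_disjoint_seqs P \<Longrightarrow> M \<subseteq> M' \<Longrightarrow> M' = M"
    and "t1_at P" "a \<longlonglongrightarrow> P" "P \<notin> range a"
  obtains T where "T \<in> M" "infinite (range T \<inter> range a)"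
proof -
  obtain g :: "nat \<Rightarrow> 'a" where g: "inj g" "range g \<subseteq> range a"
    using infinite_countable_subset[OF infinite_range_if_tendsto_t1_at[OF assms(3-5)]] by blast
  have "g \<longlonglongrightarrow> P"
    using inj_tendsto_if_range_subset assms(4) g by blast
  have "\<exists>T\<in>M. infinite (range T \<inter> range g)"
  proof (rule ccontr)
    assume "\<not> ?thesis"
    then have disj: "finite (range T \<inter> range g)" if "T \<in> M" for T
      using that by blast
    then have "pairwise (\<lambda>S T. finite (range S \<inter> range T)) (insert g M)"
      using assms(1) by (auto simp: almost_disjoint_seqs_def pairwise_insert Int_commute)
    then have "insert g M \<in> almost_disjoint_seqs P"
      using assms(1,5) g \<open>g \<longlonglongrightarrow> P\<close> by (auto simp: almost_disjoint_seqs_def)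
    then have "g \<in> M"
      using max by blast
    \<comment> \<open>Taking \<open>T = g\<close> in \<open>disj\<close> would make
      \<open>range g\<close> itself finite.\<close>
    then show False
      using disj[of g] g(1) by (simp add: finite_image_iff)
  qed
  then show thesis
    using that g(2) by (meson Int_mono finite_subset order_refl)
qed

lemma maximal_almost_disjoint_seqs_test_set:
  assumes "M \<in> almost_disjoint_seqs P"
    and "\<And>M'. M' \<in> almost_disjoint_seqs P \<Longrightarrow> M \<subseteq> M' \<Longrightarrow> M' = M"
    and "frechet_urysohn_at P" "t1_at P"
  shows "M \<in> test_sets P"
proof -
  have "M \<inter> detecting_seqs P f \<noteq> {}" if "f \<in> discont_funs P" for f
  proof -
    obtain e where e: "e > 0" "P \<in> closure {x. e \<le> \<bar>f x - f P\<bar>}"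
      using \<open>f \<in> discont_funs P\<close> unfolding discont_funs_iff by blast
    then obtain a where a: "\<And>n::nat. e \<le> \<bar>f (a n) - f P\<bar>" "a \<longlonglongrightarrow> P"
      using assms(3) unfolding frechet_urysohn_at_def by (metis (mono_tags, lifting) mem_Collect_eq)
    have "P \<notin> range a"
    proof
      assume "P \<in> range a"
      then obtain n where "a n = P"
        by auto
      then show False
        using a(1)[of n] e(1) by simp
    qed
    then obtain T where T: "T \<in> M" "infinite (range T \<inter> range a)"
      using maximal_almost_disjoint_seqs_meets[OF assms(1,2,4) a(2)] by metis
    have "\<not> (\<lambda>n. f (T n)) \<longlonglongrightarrow> f P"
    proof
      assume "(\<lambda>n. f (T n)) \<longlonglongrightarrow> f P"
      then have "\<forall>\<^sub>F n in cofinite. \<bar>f (T n) - f P\<bar> < e"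
        using e(1) by (simp add: tendsto_iff dist_real_def cofinite_eq_sequentially)
      then have "finite {n. \<not> \<bar>f (T n) - f P\<bar> < e}"
        by (simp add: eventually_cofinite)
      \<comment> \<open>Along \<open>a\<close> the values of \<open>f\<close> stay at distance at
        least \<open>e\<close> from \<open>f P\<close>, so each common point comes from an
        exceptional index of \<open>T\<close>.\<close>
      moreover have "range T \<inter> range a \<subseteq> T ` {n. \<not> \<bar>f (T n) - f P\<bar> < e}"
      proof
        fix x assume "x \<in> range T \<inter> range a"
        then obtain m n where "x = T n" "x = a m"
          by (elim IntE rangeE)
        then show "x \<in> T ` {n. \<not> \<bar>f (T n) - f P\<bar> < e}"
          using a(1)[of m] by (auto simp: not_less)
      qed
      ultimately show False
        using T(2) finite_surj by metis
    qed
    then show ?thesis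
      using T(1) assms(1) by (auto simp: almost_disjoint_seqs_def detecting_seqs_def seqs_to_def)
  qed
  then show ?thesis
    using assms(1) by (auto simp: test_sets_def almost_disjoint_seqs_def seqs_to_def)
qed

lemma almost_disjoint_seqs_subset_test_set:
  assumes "M \<in> almost_disjoint_seqs P" "B \<in> test_sets P" "B \<subseteq> M"
  shows "B = M"
proof
  show "M \<subseteq> B"
  proof
    fix T assume "T \<in> M"
    then have T: "T \<longlonglongrightarrow> P" "P \<notin> range T"
      using assms(1) by (auto simp: almost_disjoint_seqs_def)
    define f :: "'a \<Rightarrow> real" where "f = indicator (range T)"
    have "f \<in> discont_funs P"
    proof (rule ccontr)
      assume "f \<notin> discont_funs P"
      then have "(\<lambda>n. f (T n)) \<longlonglongrightarrow> f P"
        using filterlim_compose[OF _ T(1)]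
        by (auto simp: discont_funs_def topcontinuous_at_euclidean_iff)
      \<comment> \<open>Along \<open>T\<close> the function \<open>f\<close> is constantly 1, while
        \<open>f P = 0\<close>.\<close>
      then show False
        using T(2) by (simp add: f_def LIMSEQ_const_iff)
    qed
    then obtain S where S: "S \<in> B" "\<not> (\<lambda>n. f (S n)) \<longlonglongrightarrow> f P"
      using assms(2) by (auto simp: test_sets_def detecting_seqs_def)
    have "inj S"
      using S(1) assms(1,3) by (auto simp: almost_disjoint_seqs_def)
    have "infinite (range S \<inter> range T)"
    proof
      assume "finite (range S \<inter> range T)"
      then have "finite {n. S n \<in> range T}"
        using finite_vimageI[OF _ \<open>inj S\<close>, of "range S \<inter> range T"] by (simp add: vimage_def)
      then have "\<forall>\<^sub>F n in sequentially. S n \<notin> range T"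
        by (simp add: eventually_cofinite flip: cofinite_eq_sequentially)
      then have "\<forall>\<^sub>F n in sequentially. f (S n) = f P"
        by (rule eventually_mono) (use T(2) in \<open>simp add: f_def\<close>)
      then show False
        using S(2) tendsto_eventually by metis
    qed
    \<comment> \<open>Both \<open>S\<close> and \<open>T\<close> lie in \<open>M\<close>, where
      distinct members have finite intersection of ranges.\<close>
    then have "S = T"
      using assms(1,3) S(1) \<open>T \<in> M\<close> unfolding almost_disjoint_seqs_def pairwise_def by blast
    then show "T \<in> B"
      using S(1) by simp
  qed
qed (rule assms(3))

theorem theorem1p1:
  fixes P :: "'a::topological_space"
  assumes "frechet_urysohn_at P"
    and "t1_at P"
    and "P islimpt UNIV"
    and "\<exists>f :: 'a \<Rightarrow> real. f \<in> discont_funs P"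
  shows "\<exists>A \<in> test_sets P. \<forall>B \<in> test_sets P. B \<subseteq> A \<longrightarrow> B = A"
proof -
  obtain M where M: "M \<in> almost_disjoint_seqs P"
    and max: "\<And>M'. M' \<in> almost_disjoint_seqs P \<Longrightarrow> M \<subseteq> M' \<Longrightarrow> M' = M"
    using maximal_almost_disjoint_seqs by blast
  show ?thesis
    using maximal_almost_disjoint_seqs_test_set[OF M max assms(1,2)]
      almost_disjoint_seqs_subset_test_set[OF M] by blast
qed

end
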